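(* Let $f(x,\theta)\in\mathbb{R}^m$ be differentiable in $\theta\in\mathbb{R}^n$, let $\{R_{y|z}\}$ be a family of distributions with densities $r(y|z)$, $z\in\mathbb{R}^m$, and let the loss be $L(y,z)=-\log r(y|z)$. Suppose that $R_{y|z}$ is an exponential family model with natural parameters $z$, i.e. $$\log r(y|z)=z^\top T(y)-\log Z(z)$$ for some function $T(y)$, where $Z(z)$ is the normalizing constant. Then for every $(x,y)$ one has $F_R=H_L$ (both evaluated at $z=f(x,\theta)$), and consequently the Fisher information matrix equals the Generalized Gauss-Newton matrix: $F=G$.
   Context: $S$ is a finite training set of pairs $(x,y)$, and $S_x$ is the collection (with multiplicity) of the inputs $x$ in $S$. The model's conditional distribution is $P_{y|x}(\theta)=R_{y|f(x,\theta)}$. $J_f$ is the Jacobian of $f(x,\theta)$ with respect to $\theta$. $H_L$ is the Hessian of $L(y,z)$ with respect to $z$ evaluated at $z=f(x,\theta)$, and the Generalized Gauss-Newton matrix is $G=\frac{1}{|S|}\sum_{(x,y)\in S}J_f^\top H_LJ_f$. $F_R$ is the Fisher information matrix of $R_{y|z}$ with respect to $z$ at $z=f(x,\theta)$: $F_R=\mathrm{E}_{y\sim R_{y|z}}[\nabla_z\log r(y|z)\nabla_z\log r(y|z)^\top]=-\mathrm{E}_{y\sim R_{y|z}}[H_{\log r(y|z)}]$, where $H_{\log r(y|z)}$ is the Hessian in $z$; the standard regularity conditions under which these two expressions exist and agree are assumed. The Fisher information matrix of the model, with the input distribution taken to be the empirical distribution of $S_x$, is $F=\frac{1}{|S|}\sum_{x\in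 S_x}\mathrm{E}_{P_{y|x}}[\nabla\log p(y|x,\theta)\nabla\log p(y|x,\theta)^\top]=\frac{1}{|S|}\sum_{x\in S_x}J_f^\top F_RJ_f$, where $p(y|x,\theta)=r(y|f(x,\theta))$. *)

theory Defs
  imports "HOL-Probability.Probability"
begin

definition gradient :: "(real^'k \<Rightarrow> real) \<Rightarrow> real^'k \<Rightarrow> real^'k" where
  "gradient g z = (\<chi> i. frechet_derivative g (at z) (axis i 1))"

lemma gradient_eq_GDERIV:
  assumes "GDERIV g z :> D"
  shows "gradient g z = D"
proof -
  have "frechet_derivative g (at z) = (\<lambda>h. h \<bullet> D)"
    using assms unfolding gderiv_def by (metis frechet_derivative_at)
  then show ?thesis
    by (simp add: gradient_def vec_eq_iff inner_axis')
qed

definition hessian :: "(real^'k \<Rightarrow> real) \<Rightarrow> real^'k \<Rightarrow> real^'k^'k" where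
  "hessian g z = jacobian (gradient g) (at z)"

definition twice_differentiable :: "(real^'k \<Rightarrow> real) \<Rightarrow> bool" where
  "twice_differentiable g \<longleftrightarrow>
     (\<forall>z. g differentiable (at z)) \<and> (\<forall>z. gradient g differentiable (at z))"

definition outer_square :: "real^'k \<Rightarrow> real^'k^'k" where
  "outer_square v = (columnvector v :: real^1^'k) ** (rowvector v :: real^'k^1)"

text \<open>\<open>R z\<close> is a probability distribution with density \<open>r \<cdot> z\<close> with respect to the
  common base measure \<open>M\<close>.\<close>

definition distribution_family ::
    "'y measure \<Rightarrow> (real^'m \<Rightarrow> 'y measure) \<Rightarrow> ('y \<Rightarrow> real^'m \<Rightarrow> real) \<Rightarrow> bool" where
  "distribution_family M R r \<longleftrightarrow>
     (\<forall>z. (\<lambda>y. r y z) \<in> borel_measurable M \<and> (\<forall>y\<in>space M. 0 \<le> r y z) \<and>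
          R z = density M (\<lambda>y. ennreal (r y z)) \<and> prob_space (R z))"

text \<open>Positivity of \<open>r\<close> is stated explicitly because \<open>ln 0 = 0\<close> in HOL. A base density
  \<open>h(y)\<close>, if any, is absorbed into the base measure \<open>M\<close>.\<close>

definition natural_exponential_family ::
    "'y measure \<Rightarrow> ('y \<Rightarrow> real^'m \<Rightarrow> real) \<Rightarrow> ('y \<Rightarrow> real^'m) \<Rightarrow> (real^'m \<Rightarrow> real) \<Rightarrow> bool" where
  "natural_exponential_family M r T Z \<longleftrightarrow>
     (\<forall>z. Z z = (\<integral>y. exp (z \<bullet> T y) \<partial>M)) \<and>
     (\<forall>z. \<forall>y\<in>space M. 0 < r y z \<and> ln (r y z) = z \<bullet> T y - ln (Z z))"

text \<open>Fisher information at parameter value \<open>z\<close> of a family \<open>R\<close> with densities \<open>r\<close>;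
  the parameter may be the natural parameter or the weight vector of the model.\<close>

definition fisher_information ::
    "(real^'k \<Rightarrow> 'y measure) \<Rightarrow> ('y \<Rightarrow> real^'k \<Rightarrow> real) \<Rightarrow> real^'k \<Rightarrow> real^'k^'k" where
  "fisher_information R r z =
     (\<integral>y. outer_square (gradient (\<lambda>z. ln (r y z)) z) \<partial>R z)"

text \<open>The standing regularity conditions: both expressions for the Fisher information
  exist and agree.\<close>

definition fisher_regular ::
    "'y measure \<Rightarrow> (real^'k \<Rightarrow> 'y measure) \<Rightarrow> ('y \<Rightarrow> real^'k \<Rightarrow> real) \<Rightarrow> bool" where
  "fisher_regular M R r \<longleftrightarrow>
     (\<forall>y\<in>space M. twice_differentiable (\<lambda>z. ln (r y z))) \<and>
     (\<forall>z. integrable (R z) (\<lambda>y. outer_square (gradient (\<lambda>z. ln (r y z)) z)) \<and>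
          integrable (R z) (\<lambda>y. hessian (\<lambda>z. ln (r y z)) z) \<and>
          fisher_information R r z = - (\<integral>y. hessian (\<lambda>z. ln (r y z)) z \<partial>R z))"

text \<open>The training set is a multiset, so repeated training pairs are allowed;
  \<open>image_mset fst S\<close> is the collection of its inputs.\<close>

definition model_fisher ::
    "('x \<times> 'y) multiset \<Rightarrow> (real^'m \<Rightarrow> 'y measure) \<Rightarrow> ('y \<Rightarrow> real^'m \<Rightarrow> real) \<Rightarrow>
     ('x \<Rightarrow> real^'n \<Rightarrow> real^'m) \<Rightarrow> real^'n \<Rightarrow> real^'n^'n" where
  "model_fisher S R r f \<theta> = (1 / real (size S)) *\<^sub>R
     (\<Sum>x\<in>#image_mset fst S.
        fisher_information (\<lambda>\<theta>. R (f x \<theta>)) (\<lambda>y \<theta>. r y (f x \<theta>)) \<theta>)"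

definition generalized_gauss_newton ::
    "('x \<times> 'y) multiset \<Rightarrow> ('y \<Rightarrow> real^'m \<Rightarrow> real) \<Rightarrow>
     ('x \<Rightarrow> real^'n \<Rightarrow> real^'m) \<Rightarrow> real^'n \<Rightarrow> real^'n^'n" where
  "generalized_gauss_newton S L f \<theta> = (1 / real (size S)) *\<^sub>R
     (\<Sum>(x, y)\<in>#S.
        transpose (jacobian (f x) (at \<theta>)) ** hessian (L y) (f x \<theta>) ** jacobian (f x) (at \<theta>))"

end

theory Submission
  imports Defs
begin

text \<open>For a natural exponential family the log-densities for different \<open>y\<close> differ only by
  a function linear in \<open>z\<close>, so the Hessian of \<open>ln (r y z)\<close> in \<open>z\<close> does not depend on \<open>y\<close>. The
  expectation in the Hessian form of the Fisher information is therefore that of a constant,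
  and \<open>F\<^sub>R = H\<^sub>L\<close> at every \<open>y\<close>. The chain rule
  turns the score of the model into \<open>J\<^sup>T\<close> applied to the score of \<open>R\<close>, which pulls the
  congruence by \<open>J\<close> out of the expectation.\<close>

text \<open>Converse of \<open>gradient_eq_GDERIV\<close>: a linear functional on
  \<open>real^'k\<close> is determined by its values on the axis vectors, and these are the entries
  of \<open>gradient\<close>.\<close>

lemma GDERIV_gradient:
  fixes g :: "real^'k \<Rightarrow> real"
  assumes "g differentiable (at z)"
  shows "GDERIV g z :> gradient g z"
proof -
  let ?D = "frechet_derivative g (at z)"
  have D: "(g has_derivative ?D) (at z)"
    using assms by (simp add: frechet_derivative_works)
  then have "linear ?D"
    by (rule has_derivative_linear)
  have "?D h = h \<bullet> gradient g z" for h
  proof -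
    have "?D h = ?D (\<Sum>i\<in>UNIV. h $ i *\<^sub>R axis i 1)"
      using basis_expansion[of h] by (simp add: scalar_mult_eq_scaleR)
    also have "\<dots> = (\<Sum>i\<in>UNIV. h $ i * ?D (axis i 1))"
      by (simp add: linear_sum[OF \<open>linear ?D\<close>] linear_cmul[OF \<open>linear ?D\<close>])
    finally show ?thesis
      by (simp add: inner_vec_def gradient_def)
  qed
  then have "?D = (\<lambda>h. h \<bullet> gradient g z)"
    by blast
  with D show ?thesis
    by (simp add: gderiv_def)
qed

lemma jacobian_eqI:
  fixes F :: "real^'n \<Rightarrow> real^'m"
  assumes "(F has_derivative (\<lambda>h. A *v h)) (at z)"
  shows "jacobian F (at z) = A"
  by (simp add: jacobian_def flip: frechet_derivative_at[OF assms])

lemma jacobian_const_add: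
  fixes F :: "real^'n \<Rightarrow> real^'m"
  assumes "F differentiable (at z)"
  shows "jacobian (\<lambda>z. c + F z) (at z) = jacobian F (at z)"
proof (rule jacobian_eqI)
  show "((\<lambda>z. c + F z) has_derivative (\<lambda>h. jacobian F (at z) *v h)) (at z)"
    using has_derivative_add[OF has_derivative_const assms[unfolded jacobian_works]] by simp
qed

lemma jacobian_uminus:
  fixes F :: "real^'n \<Rightarrow> real^'m"
  assumes "F differentiable (at z)"
  shows "jacobian (\<lambda>z. - F z) (at z) = - jacobian F (at z)"
proof (rule jacobian_eqI)
  have "(- jacobian F (at z)) *v h = - (jacobian F (at z) *v h)" for h
    by (simp add: matrix_vector_mult_def vec_eq_iff sum_negf)
  then show "((\<lambda>z. - F z) has_derivative (\<lambda>h. (- jacobian F (at z)) *v h)) (at z)"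
    using assms[unfolded jacobian_works] by (simp add: has_derivative_minus)
qed

lemma gradient_uminus:
  fixes g :: "real^'k \<Rightarrow> real"
  assumes "g differentiable (at z)"
  shows "gradient (\<lambda>z. - g z) z = - gradient g z"
  by (intro gradient_eq_GDERIV GDERIV_minus GDERIV_gradient assms)

lemma hessian_uminus:
  fixes g :: "real^'k \<Rightarrow> real"
  assumes "twice_differentiable g"
  shows "hessian (\<lambda>z. - g z) z = - hessian g z"
proof -
  \<comment> \<open>The identity is needed at every point, since the Hessian differentiates the
    gradient as a function.\<close>
  have "gradient (\<lambda>z. - g z) = (\<lambda>z. - gradient g z)"
    using assms by (auto simp: twice_differentiable_def gradient_uminus)
  then show ?thesis
    using assms by (simp add: hessian_def jacobian_uminus twice_differentiable_def)
qed

text \<open>The linear term shifts the gradient by the constant \<open>t\<close>, which the second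
  differentiation removes.\<close>

lemma hessian_linear_add:
  fixes g :: "real^'k \<Rightarrow> real"
  assumes "twice_differentiable g"
  shows "hessian (\<lambda>z. z \<bullet> t + g z) z = hessian g z"
proof -
  have "GDERIV (\<lambda>z. z \<bullet> t + g z) z :> t + gradient g z" for z
  proof (rule GDERIV_add)
    show "GDERIV (\<lambda>z. z \<bullet> t) z :> t"
      unfolding gderiv_def by (intro derivative_intros)
    show "GDERIV g z :> gradient g z"
      using assms by (simp add: twice_differentiable_def GDERIV_gradient)
  qed
  then have "gradient (\<lambda>z. z \<bullet> t + g z) = (\<lambda>z. t + gradient g z)"
    by (intro ext gradient_eq_GDERIV)
  then show ?thesis
    using assms by (simp add: hessian_def jacobian_const_add twice_differentiable_def)
qed

lemma gradient_compose:
  fixes g :: "real^'m \<Rightarrow> real" and F :: "real^'n \<Rightarrow> real^'m"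
  assumes "g differentiable (at (F \<theta>))" and "F differentiable (at \<theta>)"
  shows "gradient (\<lambda>\<theta>. g (F \<theta>)) \<theta> = transpose (jacobian F (at \<theta>)) *v gradient g (F \<theta>)"
proof (rule gradient_eq_GDERIV)
  have "((\<lambda>\<theta>. g (F \<theta>)) has_derivative
      (\<lambda>h. (jacobian F (at \<theta>) *v h) \<bullet> gradient g (F \<theta>))) (at \<theta>)"
    using has_derivative_compose[OF assms(2)[unfolded jacobian_works]
        GDERIV_gradient[OF assms(1), unfolded gderiv_def]] .
  moreover have "(jacobian F (at \<theta>) *v h) \<bullet> gradient g (F \<theta>) =
      h \<bullet> (transpose (jacobian F (at \<theta>)) *v gradient g (F \<theta>))" for h
    \<comment> \<open>The simplifier writes the transposed product with \<open>v*\<close>, and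
      \<open>dot_lmul_matrix\<close> then moves the Jacobian across the inner product.\<close>
    by (simp add: inner_commute[of _ "gradient g (F \<theta>)"] inner_commute[of h] dot_lmul_matrix)
  ultimately show "GDERIV (\<lambda>\<theta>. g (F \<theta>)) \<theta> :> transpose (jacobian F (at \<theta>)) *v gradient g (F \<theta>)"
    by (simp add: gderiv_def)
qed

lemma outer_square_nth: "outer_square v $ i $ j = v $ i * v $ j"
  by (simp add: outer_square_def matrix_matrix_mult_def columnvector_def rowvector_def)

text \<open>Each entry of either side is the same double sum over k and l. Taking \<open>A\<close>
  to be a transposed Jacobian gives the congruence in the Gauss-Newton matrix.\<close>

lemma outer_square_matrix_vector_mult:
  fixes A :: "real^'k^'n"
  shows "outer_square (A *v v) = A ** outer_square v ** transpose A"
proof -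
  have "(A ** outer_square v ** transpose A) $ i $ j = (A *v v) $ i * (A *v v) $ j" for i j
  proof -
    have "(A ** outer_square v ** transpose A) $ i $ j =
        (\<Sum>l\<in>UNIV. \<Sum>k\<in>UNIV. A $ i $ k * (v $ k * v $ l) * A $ j $ l)"
      by (simp add: matrix_matrix_mult_def transpose_def outer_square_nth sum_distrib_right)
    also have "\<dots> = (\<Sum>k\<in>UNIV. \<Sum>l\<in>UNIV. (A $ i $ k * v $ k) * (A $ j $ l * v $ l))"
      by (subst sum.swap) (simp add: mult_ac)
    finally show ?thesis
      by (simp add: matrix_vector_mult_def sum_product)
  qed
  then show ?thesis
    by (simp add: vec_eq_iff outer_square_nth)
qed

text \<open>Linear maps in finite dimension are bounded, and bounded linear maps commute with the
  Bochner integral.\<close>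

lemma bounded_linear_congruence:
  fixes A :: "real^'k^'n" and B :: "real^'p^'l"
  shows "bounded_linear (\<lambda>X :: real^'l^'k. A ** X ** B)"
  by (intro linear_conv_bounded_linear[THEN iffD1] linearI)
     (simp_all add: vec_eq_iff matrix_matrix_mult_def sum.distrib distrib_left distrib_right
      sum_distrib_left sum_distrib_right mult_ac)

text \<open>The term \<open>ln (Z z)\<close> is common to all outcomes and cancels in the difference
  of two log-densities, so \<open>Z\<close> itself is never differentiated.\<close>

lemma hessian_log_density_independent:
  assumes "natural_exponential_family M r T Z" and "y \<in> space M" and "y' \<in> space M"
    and "twice_differentiable (\<lambda>z. ln (r y z))"
  shows "hessian (\<lambda>z. ln (r y' z)) z = hessian (\<lambda>z. ln (r y z)) z"
proof -
  have "(\<lambda>z. ln (r y' z)) = (\<lambda>z. z \<bullet> (T y' - T y) + ln (r y z))"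
    using assms(1-3) by (auto simp: natural_exponential_family_def inner_diff_right)
  then show ?thesis
    using hessian_linear_add[OF assms(4)] by simp
qed

lemma fisher_information_natural_exponential_family:
  assumes "distribution_family M R r" and regular: "fisher_regular M R r"
    and exp_family: "natural_exponential_family M r T Z" and y: "y \<in> space M"
  shows "fisher_information R r z = hessian (\<lambda>z. - ln (r y z)) z"
proof -
  have R: "prob_space (R z)" "space (R z) = space M"
    using assms(1) unfolding distribution_family_def by (blast, simp)
  interpret prob_space "R z"
    by (fact R)
  have twice: "twice_differentiable (\<lambda>z. ln (r y z))"
    using regular y by (simp add: fisher_regular_def)
  \<comment> \<open>The outcome in the integrand is frozen at the fixed \<open>y\<close>; the two
    integrands agree on \<open>space M\<close>, which is the space of \<open>R z\<close>.\<close>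
  have "(\<integral>y'. hessian (\<lambda>z. ln (r y' z)) z \<partial>R z) = (\<integral>y'. hessian (\<lambda>z. ln (r y z)) z \<partial>R z)"
    using hessian_log_density_independent[OF exp_family y _ twice]
    by (intro Bochner_Integration.integral_cong) (simp_all add: R)
  \<comment> \<open>Regularity supplies the Hessian form, and total mass 1 (the fact
    \<open>prob_space\<close>) makes the integral of a constant that constant.\<close>
  then have "fisher_information R r z = - hessian (\<lambda>z. ln (r y z)) z"
    using regular by (simp add: fisher_regular_def prob_space)
  then show ?thesis
    by (simp add: hessian_uminus[OF twice])
qed

lemma fisher_information_compose:
  fixes F :: "real^'n \<Rightarrow> real^'m"
  assumes "distribution_family M R r" and regular: "fisher_regular M R r"
    and F: "F differentiable (at \<theta>)"
  shows "fisher_information (\<lambda>\<theta>. R (F \<theta>)) (\<lambda>y \<theta>. r y (F \<theta>)) \<theta> =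
    transpose (jacobian F (at \<theta>)) ** fisher_information R r (F \<theta>) ** jacobian F (at \<theta>)"
proof -
  let ?J = "jacobian F (at \<theta>)"
  let ?score = "\<lambda>y. gradient (\<lambda>z. ln (r y z)) (F \<theta>)"
  have "space (R (F \<theta>)) = space M"
    using assms(1) by (auto simp: distribution_family_def)
  then have "outer_square (gradient (\<lambda>\<theta>. ln (r y (F \<theta>))) \<theta>) =
      transpose ?J ** outer_square (?score y) ** ?J" if "y \<in> space (R (F \<theta>))" for y
    using that regular gradient_compose[where g = "\<lambda>z. ln (r y z)", OF _ F]
    \<comment> \<open>The score must keep the form \<open>transpose ?J *v _\<close> for the
      outer-square identity to match; \<open>transpose_matrix_vector\<close> would rewrite it with
      \<open>v*\<close>.\<close>
    by (simp add: fisher_regular_def twice_differentiable_def outer_square_matrix_vector_mult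
        del: transpose_matrix_vector)
  then have "fisher_information (\<lambda>\<theta>. R (F \<theta>)) (\<lambda>y \<theta>. r y (F \<theta>)) \<theta> =
      (\<integral>y. transpose ?J ** outer_square (?score y) ** ?J \<partial>R (F \<theta>))"
    unfolding fisher_information_def by (intro Bochner_Integration.integral_cong) simp_all
  also have "\<dots> = transpose ?J ** fisher_information R r (F \<theta>) ** ?J"
    unfolding fisher_information_def
    using regular by (intro integral_bounded_linear bounded_linear_congruence)
      (simp add: fisher_regular_def)
  finally show ?thesis .
qed

theorem mainTheorem6:
  fixes S :: "('x \<times> 'y) multiset"
    and M :: "'y measure"
    and f :: "'x \<Rightarrow> real^'n \<Rightarrow> real^'m"
    and R :: "real^'m \<Rightarrow> 'y measure"
    and r :: "'y \<Rightarrow> real^'m \<Rightarrow> real"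
    and L :: "'y \<Rightarrow> real^'m \<Rightarrow> real"
    and T :: "'y \<Rightarrow> real^'m"
    and Z :: "real^'m \<Rightarrow> real"
    and \<theta> :: "real^'n"
  assumes S_nonempty: "S \<noteq> {#}"
    and S_space: "\<And>x y. (x, y) \<in># S \<Longrightarrow> y \<in> space M"
    and f_diff: "\<And>x \<theta>. f x differentiable (at \<theta>)"
    and family: "distribution_family M R r"
    and loss: "\<And>y z. L y z = - ln (r y z)"
    and regular: "fisher_regular M R r"
    and exp_family: "natural_exponential_family M r T Z"
  shows "(\<forall>x. \<forall>y\<in>space M. fisher_information R r (f x \<theta>) = hessian (L y) (f x \<theta>)) \<and>
         model_fisher S R r f \<theta> = generalized_gauss_newton S L f \<theta>"
proof -
  have L: "L y = (\<lambda>z. - ln (r y z))" for y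
    using loss by blast
  have FR: "fisher_information R r z = hessian (L y) z" if "y \<in> space M" for y z
    unfolding L using fisher_information_natural_exponential_family[OF family regular exp_family that] .
  have "model_fisher S R r f \<theta> = generalized_gauss_newton S L f \<theta>"
    \<comment> \<open>Fusing the two image multisets makes both sums range over the pairs in
      \<open>S\<close>. They are then compared pair by pair: the Fisher term ignores the label, and
      \<open>FR\<close> equates its inner matrix with the Hessian at that label.\<close>
    unfolding model_fisher_def generalized_gauss_newton_def multiset.map_comp
    by (intro arg_cong[where f = "(*\<^sub>R) _"] arg_cong[where f = sum_mset] image_mset_cong)
       (auto simp: fisher_information_compose[OF family regular f_diff] FR[OF S_space])
  with FR show ?thesis
    by blast
qed

end
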